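(* Let $X$ be a heap and let $A$ be an abelian group. There is a bijective correspondence between isomorphism classes of heap extensions of $X$ by $A$ and the second heap cohomology group $H^2_{\rm H}(X,A)$.
   Context: A heap is a non-empty set $X$ with a ternary operation $[x,y,z]$ satisfying, for all elements, para-associativity $[[x_1,x_2,x_3],x_4,x_5]=[x_1,[x_4,x_3,x_2],x_5]=[x_1,x_2,[x_3,x_4,x_5]]$ and the degeneracy conditions $[x,x,y]=y$, $[x,y,y]=x$. Cochains: $C^1_{\rm PA}(X,A)$ is the group of functions $X\to A$ and $C^2_{\rm PA}(X,A)$ the group of functions $X^3\to A$. Put $\delta^1 f(x,y,z)=f([x,y,z])-f(x)+f(y)-f(z)$, and for $\eta\in C^2_{\rm PA}(X,A)$ $\delta^2_{(1)}\eta(x_1,\dots,x_5)=\eta(x_1,x_2,x_3)+\eta([x_1,x_2,x_3],x_4,x_5)+\eta(x_4,x_3,x_2)-\eta(x_1,[x_4,x_3,x_2],x_5)$, $\delta^2_{(2)}\eta(x_1,\dots,x_5)=\eta(x_3,x_4,x_5)+\eta(x_1,x_2,[x_3,x_4,x_5])+\eta(x_4,x_3,x_2)-\eta(x_1,[x_4,x_3,x_2],x_5)$. $Z^2_{\rm PA}(X,A)=\{\eta:\delta^2_{(1)}\eta=0=\delta^2_{(2)}\eta\}$ and $B^2_{\rm PA}(X,A)=\mathrm{im}(\delta^1)$. The heap cocycle group $Z^2_{\rm H}(X,A)$ consists of those $\eta\in Z^2_{\rm PA}(X,A)$ with $\eta(x,x,y)=0=\eta(x,y,y)$ for all $x,y\in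 X$ (it contains $B^2_{\rm PA}(X,A)$), and $H^2_{\rm H}(X,A)=Z^2_{\rm H}(X,A)/B^2_{\rm PA}(X,A)$. Heap extensions: for $\eta\in Z^2_{\rm H}(X,A)$, the heap extension $X\times_\eta A$ is the set $X\times A$ with operation $[(x,a),(y,b),(z,c)]=([x,y,z],a-b+c+\eta(x,y,z))$. A morphism of extensions $\phi:X\times_\eta A\to X\times_{\eta'}A$ is a morphism of heaps (a map commuting with the ternary operations) that commutes with the projections $X\times A\to X$. An isomorphism of extensions is an invertible morphism of extensions; this induces an equivalence relation, whose equivalence classes are the isomorphism classes.
   Formalization: Morphisms of extensions must also commute with translation by A on fibres; without this the claim fails (X = A = Z/3: isomorphism classes correspond to H²_H modulo Aut(A), giving 2 classes against 3 elements). *)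

theory Defs
  imports "HOL-Algebra.Coset" "HOL-Algebra.Product_Groups"
begin

record 'x ternary = "'x partial_object" +
  tern :: "'x \<Rightarrow> 'x \<Rightarrow> 'x \<Rightarrow> 'x"

locale heap =
  fixes X :: "('x, 'm) ternary_scheme"
  assumes nonempty: "carrier X \<noteq> {}"
    and closed: "\<lbrakk>x \<in> carrier X; y \<in> carrier X; z \<in> carrier X\<rbrakk> \<Longrightarrow> tern X x y z \<in> carrier X"
    and para_assoc_left:
      "\<lbrakk>x1 \<in> carrier X; x2 \<in> carrier X; x3 \<in> carrier X; x4 \<in> carrier X; x5 \<in> carrier X\<rbrakk>
        \<Longrightarrow> tern X (tern X x1 x2 x3) x4 x5 = tern X x1 (tern X x4 x3 x2) x5"
    and para_assoc_right:
      "\<lbrakk>x1 \<in> carrier X; x2 \<in> carrier X; x3 \<in> carrier X; x4 \<in> carrier X; x5 \<in> carrier X\<rbrakk>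
        \<Longrightarrow> tern X x1 (tern X x4 x3 x2) x5 = tern X x1 x2 (tern X x3 x4 x5)"
    and degenerate_left: "\<lbrakk>x \<in> carrier X; y \<in> carrier X\<rbrakk> \<Longrightarrow> tern X x x y = y"
    and degenerate_right: "\<lbrakk>x \<in> carrier X; y \<in> carrier X\<rbrakk> \<Longrightarrow> tern X x y y = x"

definition heap_hom :: "('x, 'm) ternary_scheme \<Rightarrow> ('y, 'n) ternary_scheme \<Rightarrow> ('x \<Rightarrow> 'y) set" where
  "heap_hom H K = {\<phi>. \<phi> \<in> carrier H \<rightarrow> carrier K \<and>
     (\<forall>x\<in>carrier H. \<forall>y\<in>carrier H. \<forall>z\<in>carrier H.
        \<phi> (tern H x y z) = tern K (\<phi> x) (\<phi> y) (\<phi> z))}"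

text \<open>
  The abelian group \<open>A\<close> is written multiplicatively, following HOL-Algebra.
  Cochains are extensional functions, so that they are determined by their values on the
  carrier of \<open>X\<close>, and form a group under pointwise multiplication.
\<close>

definition C1_PA ::
  "('x, 'm) ternary_scheme \<Rightarrow> ('a, 'b) monoid_scheme \<Rightarrow> ('x \<Rightarrow> 'a) monoid" where
  "C1_PA X A = product_group (carrier X) (\<lambda>_. A)"

definition C2_PA ::
  "('x, 'm) ternary_scheme \<Rightarrow> ('a, 'b) monoid_scheme \<Rightarrow> ('x \<times> 'x \<times> 'x \<Rightarrow> 'a) monoid" where
  "C2_PA X A = product_group (carrier X \<times> carrier X \<times> carrier X) (\<lambda>_. A)"

definition delta1 ::
  "('x, 'm) ternary_scheme \<Rightarrow> ('a, 'b) monoid_scheme \<Rightarrow> ('x \<Rightarrow> 'a) \<Rightarrow> ('x \<times> 'x \<times> 'x \<Rightarrow> 'a)" where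
  "delta1 X A f = (\<lambda>(x, y, z) \<in> carrier X \<times> carrier X \<times> carrier X.
     f (tern X x y z) \<otimes>\<^bsub>A\<^esub> inv\<^bsub>A\<^esub> f x \<otimes>\<^bsub>A\<^esub> f y \<otimes>\<^bsub>A\<^esub> inv\<^bsub>A\<^esub> f z)"

definition delta2_1 ::
  "('x, 'm) ternary_scheme \<Rightarrow> ('a, 'b) monoid_scheme \<Rightarrow> ('x \<times> 'x \<times> 'x \<Rightarrow> 'a)
     \<Rightarrow> 'x \<Rightarrow> 'x \<Rightarrow> 'x \<Rightarrow> 'x \<Rightarrow> 'x \<Rightarrow> 'a" where
  "delta2_1 X A \<eta> x1 x2 x3 x4 x5 =
     \<eta> (x1, x2, x3) \<otimes>\<^bsub>A\<^esub> \<eta> (tern X x1 x2 x3, x4, x5) \<otimes>\<^bsub>A\<^esub> \<eta> (x4, x3, x2)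
       \<otimes>\<^bsub>A\<^esub> inv\<^bsub>A\<^esub> \<eta> (x1, tern X x4 x3 x2, x5)"

definition delta2_2 ::
  "('x, 'm) ternary_scheme \<Rightarrow> ('a, 'b) monoid_scheme \<Rightarrow> ('x \<times> 'x \<times> 'x \<Rightarrow> 'a)
     \<Rightarrow> 'x \<Rightarrow> 'x \<Rightarrow> 'x \<Rightarrow> 'x \<Rightarrow> 'x \<Rightarrow> 'a" where
  "delta2_2 X A \<eta> x1 x2 x3 x4 x5 =
     \<eta> (x3, x4, x5) \<otimes>\<^bsub>A\<^esub> \<eta> (x1, x2, tern X x3 x4 x5) \<otimes>\<^bsub>A\<^esub> \<eta> (x4, x3, x2)
       \<otimes>\<^bsub>A\<^esub> inv\<^bsub>A\<^esub> \<eta> (x1, tern X x4 x3 x2, x5)"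

definition Z2_PA ::
  "('x, 'm) ternary_scheme \<Rightarrow> ('a, 'b) monoid_scheme \<Rightarrow> ('x \<times> 'x \<times> 'x \<Rightarrow> 'a) set" where
  "Z2_PA X A = {\<eta> \<in> carrier (C2_PA X A).
     \<forall>x1\<in>carrier X. \<forall>x2\<in>carrier X. \<forall>x3\<in>carrier X. \<forall>x4\<in>carrier X. \<forall>x5\<in>carrier X.
       delta2_1 X A \<eta> x1 x2 x3 x4 x5 = \<one>\<^bsub>A\<^esub> \<and> delta2_2 X A \<eta> x1 x2 x3 x4 x5 = \<one>\<^bsub>A\<^esub>}"

definition B2_PA ::
  "('x, 'm) ternary_scheme \<Rightarrow> ('a, 'b) monoid_scheme \<Rightarrow> ('x \<times> 'x \<times> 'x \<Rightarrow> 'a) set" where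
  "B2_PA X A = delta1 X A ` carrier (C1_PA X A)"

definition Z2_H ::
  "('x, 'm) ternary_scheme \<Rightarrow> ('a, 'b) monoid_scheme \<Rightarrow> ('x \<times> 'x \<times> 'x \<Rightarrow> 'a) monoid" where
  "Z2_H X A = (C2_PA X A)\<lparr>carrier := {\<eta> \<in> Z2_PA X A.
     \<forall>x\<in>carrier X. \<forall>y\<in>carrier X. \<eta> (x, x, y) = \<one>\<^bsub>A\<^esub> \<and> \<eta> (x, y, y) = \<one>\<^bsub>A\<^esub>}\<rparr>"

definition H2_H ::
  "('x, 'm) ternary_scheme \<Rightarrow> ('a, 'b) monoid_scheme \<Rightarrow> ('x \<times> 'x \<times> 'x \<Rightarrow> 'a) set monoid" where
  "H2_H X A = Z2_H X A Mod B2_PA X A"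

definition heap_extension ::
  "('x, 'm) ternary_scheme \<Rightarrow> ('a, 'b) monoid_scheme \<Rightarrow> ('x \<times> 'x \<times> 'x \<Rightarrow> 'a)
     \<Rightarrow> ('x \<times> 'a) ternary" where
  "heap_extension X A \<eta> = \<lparr>carrier = carrier X \<times> carrier A,
     tern = (\<lambda>(x, a) (y, b) (z, c).
       (tern X x y z, a \<otimes>\<^bsub>A\<^esub> inv\<^bsub>A\<^esub> b \<otimes>\<^bsub>A\<^esub> c \<otimes>\<^bsub>A\<^esub> \<eta> (x, y, z)))\<rparr>"

definition heap_extensions ::
  "('x, 'm) ternary_scheme \<Rightarrow> ('a, 'b) monoid_scheme \<Rightarrow> ('x \<times> 'a) ternary set" where
  "heap_extensions X A = heap_extension X A ` carrier (Z2_H X A)"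

text \<open>
  A morphism of extensions is a heap morphism over \<open>X\<close> that is also compatible with the
  translation action of \<open>A\<close> on the fibres.  The last clause cannot be dropped: a heap
  isomorphism over \<open>X\<close> has in general the form \<open>(x, a) \<mapsto> (x, f x + h a)\<close>
  with an automorphism \<open>h\<close> of \<open>A\<close>, so without it the extensions defined by \<open>\<eta>\<close> and
  \<open>h \<circ> \<eta>\<close> would always be isomorphic.  For \<open>X = A = \<int>/3\<close>, where the second heap
  cohomology group has order 3, there would be only two isomorphism classes.
\<close>

definition extension_hom ::
  "('a, 'b) monoid_scheme \<Rightarrow> ('x \<times> 'a) ternary \<Rightarrow> ('x \<times> 'a) ternary \<Rightarrow> ('x \<times> 'a \<Rightarrow> 'x \<times> 'a) set" where
  "extension_hom A E F = {\<phi> \<in> heap_hom E F.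
     (\<forall>p\<in>carrier E. fst (\<phi> p) = fst p) \<and>
     (\<forall>(x, a)\<in>carrier E. \<forall>b\<in>carrier A. \<phi> (x, a \<otimes>\<^bsub>A\<^esub> b) = map_prod id (\<lambda>c. c \<otimes>\<^bsub>A\<^esub> b) (\<phi> (x, a)))}"

definition extension_isomorphic ::
  "('a, 'b) monoid_scheme \<Rightarrow> ('x \<times> 'a) ternary \<Rightarrow> ('x \<times> 'a) ternary \<Rightarrow> bool" where
  "extension_isomorphic A E F \<longleftrightarrow> (\<exists>\<phi>\<in>extension_hom A E F. \<exists>\<psi>\<in>extension_hom A F E.
     (\<forall>p\<in>carrier E. \<psi> (\<phi> p) = p) \<and> (\<forall>q\<in>carrier F. \<phi> (\<psi> q) = q))"

definition extension_iso_rel ::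
  "('x, 'm) ternary_scheme \<Rightarrow> ('a, 'b) monoid_scheme
     \<Rightarrow> (('x \<times> 'a) ternary \<times> ('x \<times> 'a) ternary) set" where
  "extension_iso_rel X A = {(E, F). E \<in> heap_extensions X A \<and> F \<in> heap_extensions X A \<and>
     extension_isomorphic A E F}"

definition extension_iso_classes ::
  "('x, 'm) ternary_scheme \<Rightarrow> ('a, 'b) monoid_scheme \<Rightarrow> ('x \<times> 'a) ternary set set" where
  "extension_iso_classes X A = heap_extensions X A // extension_iso_rel X A"

end

theory Submission
  imports Defs
begin

text \<open>
  Write \<open>A\<close> additively for the moment.  A map \<open>X \<times> A \<rightarrow> X \<times> A\<close> over \<open>X\<close> that commutes with the
  translations by \<open>A\<close> is a shear \<open>(x, a) \<mapsto> (x, f x + a)\<close>: it is determined by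
  the function \<open>f\<close> that it induces on the section \<open>x \<mapsto> (x, 0)\<close>.  When the shear is applied to a
  ternary product, the terms \<open>a - b + c\<close> cancel, and what remains of the condition that it is
  a morphism from the extension of \<open>\<eta>\<close> to that of \<open>\<eta>'\<close> is \<open>\<eta> + \<delta>\<^sup>1 f = \<eta>'\<close>
  (\<open>shear_hom_iff\<close>).  The shear by \<open>-f\<close> is its inverse, so every morphism of extensions is an
  isomorphism, and the extensions of \<open>\<eta>\<close> and \<open>\<eta>'\<close> are isomorphic exactly if
  \<open>\<eta>\<close> and \<open>\<eta>'\<close> lie in the same coset of the coboundaries (\<open>extension_isomorphic_iff_rcos_eq\<close>).
  Hence isomorphism classes and cosets are two descriptions of the same partition of the
  cocycles.

  For the cosets to form a quotient of the cocycle group, the coboundaries must be a subgroup of it.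
  This rests on \<open>\<delta>\<^sup>1\<close> and \<open>\<delta>\<^sup>2\<close> being homomorphisms and on
  \<open>\<delta>\<^sup>2 \<delta>\<^sup>1 = 0\<close>, where para-associativity of \<open>X\<close> identifies the terms
  that involve five variables.
\<close>

section \<open>Quotients along an invariant\<close>

text \<open>
  Distinct parameters \<open>z\<close> may describe the same object \<open>e z\<close>, so the value on a class cannot be
  defined from a parameter directly: the map chooses one of the parameters whose object lies in
  the class, and completeness of the invariant \<open>q\<close> makes the choice irrelevant.
\<close>

lemma quotient_bij_betw_complete_invariant:
  assumes sub: "R \<subseteq> (e ` Z) \<times> (e ` Z)"
    and inv: "\<And>z w. z \<in> Z \<Longrightarrow> w \<in> Z \<Longrightarrow> (e z, e w) \<in> R \<longleftrightarrow> q z = q w"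
  shows "\<exists>\<Phi>. bij_betw \<Phi> ((e ` Z) // R) (q ` Z) \<and> (\<forall>z\<in>Z. \<Phi> (R `` {e z}) = q z)"
proof -
  define \<Phi> where "\<Phi> c = q (SOME w. w \<in> Z \<and> e w \<in> c)" for c
  have \<Phi>: "\<Phi> (R `` {e z}) = q z" if z: "z \<in> Z" for z
  proof -
    have "z \<in> Z \<and> e z \<in> R `` {e z}" using inv z by blast
    then have "(SOME w. w \<in> Z \<and> e w \<in> R `` {e z}) \<in> Z \<and>
        e (SOME w. w \<in> Z \<and> e w \<in> R `` {e z}) \<in> R `` {e z}"
      by (rule someI)
    then show ?thesis
      unfolding \<Phi>_def using inv[OF z] by (metis Image_singleton_iff)
  qed
  have class_eq: "R `` {e z} = R `` {e w}" if z: "z \<in> Z" and w: "w \<in> Z" and eq: "q z = q w" for z w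
  proof (rule Set.set_eqI)
    fix y
    have "y \<in> R `` {e z} \<longleftrightarrow> (\<exists>v\<in>Z. y = e v \<and> q z = q v)" if "z \<in> Z" for z
      using sub inv[OF that] by blast
    from this[OF z] this[OF w] show "y \<in> R `` {e z} \<longleftrightarrow> y \<in> R `` {e w}"
      using eq by simp
  qed
  have quot: "(e ` Z) // R = (\<lambda>z. R `` {e z}) ` Z"
    by (auto simp: quotient_def)
  have "inj_on \<Phi> ((e ` Z) // R)"
    unfolding quot inj_on_def by (auto simp: \<Phi> dest: class_eq)
  moreover have "\<Phi> ` ((e ` Z) // R) = q ` Z"
    unfolding quot image_image using \<Phi> by (rule image_cong[OF refl])
  ultimately show ?thesis
    unfolding bij_betw_def using \<Phi> by blast
qed

section \<open>Cochains, cocycles and coboundaries\<close>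

locale heap_coefficients = X: heap X + comm_group A
  for X :: "('x, 'm) ternary_scheme" and A :: "('a, 'b) monoid_scheme" (structure)
begin

lemma tern_closed [simp, intro]:
  "x \<in> carrier X \<Longrightarrow> y \<in> carrier X \<Longrightarrow> z \<in> carrier X \<Longrightarrow> tern X x y z \<in> carrier X"
  by (rule X.closed)

lemma group_C1: "group (C1_PA X A)"
  and group_C2: "group (C2_PA X A)"
  unfolding C1_PA_def C2_PA_def by simp_all

lemma C1_value_closed [simp]: "f \<in> carrier (C1_PA X A) \<Longrightarrow> x \<in> carrier X \<Longrightarrow> f x \<in> carrier A"
  by (auto simp: C1_PA_def)

lemma C2_value_closed [simp]:
  "\<eta> \<in> carrier (C2_PA X A) \<Longrightarrow> x \<in> carrier X \<Longrightarrow> y \<in> carrier X \<Longrightarrow> z \<in> carrier X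
    \<Longrightarrow> \<eta> (x, y, z) \<in> carrier A"
  by (auto simp: C2_PA_def)

lemma C1_mult_apply [simp]:
  "x \<in> carrier X \<Longrightarrow> (f \<otimes>\<^bsub>C1_PA X A\<^esub> g) x = f x \<otimes> g x"
  by (simp add: C1_PA_def)

lemma C2_mult_apply [simp]:
  "x \<in> carrier X \<Longrightarrow> y \<in> carrier X \<Longrightarrow> z \<in> carrier X \<Longrightarrow>
    (\<eta> \<otimes>\<^bsub>C2_PA X A\<^esub> \<mu>) (x, y, z) = \<eta> (x, y, z) \<otimes> \<mu> (x, y, z)"
  by (simp add: C2_PA_def)

lemma C2_one_apply [simp]:
  "x \<in> carrier X \<Longrightarrow> y \<in> carrier X \<Longrightarrow> z \<in> carrier X \<Longrightarrow> \<one>\<^bsub>C2_PA X A\<^esub> (x, y, z) = \<one>"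
  by (simp add: C2_PA_def)

lemma C1_inv_apply [simp]:
  "f \<in> carrier (C1_PA X A) \<Longrightarrow> x \<in> carrier X \<Longrightarrow> (inv\<^bsub>C1_PA X A\<^esub> f) x = inv (f x)"
  by (simp add: C1_PA_def)

lemma C2_inv_apply [simp]:
  "\<eta> \<in> carrier (C2_PA X A) \<Longrightarrow> x \<in> carrier X \<Longrightarrow> y \<in> carrier X \<Longrightarrow> z \<in> carrier X \<Longrightarrow>
    (inv\<^bsub>C2_PA X A\<^esub> \<eta>) (x, y, z) = inv (\<eta> (x, y, z))"
  by (simp add: C2_PA_def)

lemma C2_eqI:
  assumes "\<eta> \<in> carrier (C2_PA X A)" "\<mu> \<in> carrier (C2_PA X A)"
    and "\<And>x y z. x \<in> carrier X \<Longrightarrow> y \<in> carrier X \<Longrightarrow> z \<in> carrier X \<Longrightarrow> \<eta> (x, y, z) = \<mu> (x, y, z)"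
  shows "\<eta> = \<mu>"
  by (rule PiE_ext[of \<eta> "carrier X \<times> carrier X \<times> carrier X" "\<lambda>_. carrier A"])
    (use assms in \<open>auto simp: C2_PA_def\<close>)

lemma delta1_apply [simp]:
  "x \<in> carrier X \<Longrightarrow> y \<in> carrier X \<Longrightarrow> z \<in> carrier X \<Longrightarrow>
    delta1 X A f (x, y, z) = f (tern X x y z) \<otimes> inv (f x) \<otimes> f y \<otimes> inv (f z)"
  by (simp add: delta1_def)

lemma delta1_closed [simp]: "f \<in> carrier (C1_PA X A) \<Longrightarrow> delta1 X A f \<in> carrier (C2_PA X A)"
  by (auto simp: delta1_def C1_PA_def C2_PA_def PiE_iff extensional_def)

lemma delta1_hom: "delta1 X A \<in> hom (C1_PA X A) (C2_PA X A)"
proof (rule homI)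
  fix f g assume f: "f \<in> carrier (C1_PA X A)" and g: "g \<in> carrier (C1_PA X A)"
  have fg: "f \<otimes>\<^bsub>C1_PA X A\<^esub> g \<in> carrier (C1_PA X A)"
    using f g group_C1 by (simp add: group.is_monoid monoid.m_closed)
  show "delta1 X A (f \<otimes>\<^bsub>C1_PA X A\<^esub> g) = delta1 X A f \<otimes>\<^bsub>C2_PA X A\<^esub> delta1 X A g"
    by (rule C2_eqI)
      (use f g fg group_C2 in \<open>simp_all add: group.is_monoid monoid.m_closed inv_mult m_ac\<close>)
qed simp

lemma delta1_group_hom: "group_hom (C1_PA X A) (C2_PA X A) (delta1 X A)"
  using group_C1 group_C2 delta1_hom by (simp add: group_hom_def group_hom_axioms_def)

lemma B2_subgroup_C2: "subgroup (B2_PA X A) (C2_PA X A)"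
  unfolding B2_PA_def by (rule group_hom.img_is_subgroup[OF delta1_group_hom])

lemma delta2_1_mult:
  assumes "\<eta> \<in> carrier (C2_PA X A)" "\<mu> \<in> carrier (C2_PA X A)"
    and "x1 \<in> carrier X" "x2 \<in> carrier X" "x3 \<in> carrier X" "x4 \<in> carrier X" "x5 \<in> carrier X"
  shows "delta2_1 X A (\<eta> \<otimes>\<^bsub>C2_PA X A\<^esub> \<mu>) x1 x2 x3 x4 x5
    = delta2_1 X A \<eta> x1 x2 x3 x4 x5 \<otimes> delta2_1 X A \<mu> x1 x2 x3 x4 x5"
  using assms by (simp add: delta2_1_def inv_mult m_ac)

lemma delta2_2_mult:
  assumes "\<eta> \<in> carrier (C2_PA X A)" "\<mu> \<in> carrier (C2_PA X A)"
    and "x1 \<in> carrier X" "x2 \<in> carrier X" "x3 \<in> carrier X" "x4 \<in> carrier X" "x5 \<in> carrier X"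
  shows "delta2_2 X A (\<eta> \<otimes>\<^bsub>C2_PA X A\<^esub> \<mu>) x1 x2 x3 x4 x5
    = delta2_2 X A \<eta> x1 x2 x3 x4 x5 \<otimes> delta2_2 X A \<mu> x1 x2 x3 x4 x5"
  using assms by (simp add: delta2_2_def inv_mult m_ac)

lemma delta2_1_inv:
  assumes "\<eta> \<in> carrier (C2_PA X A)"
    and "x1 \<in> carrier X" "x2 \<in> carrier X" "x3 \<in> carrier X" "x4 \<in> carrier X" "x5 \<in> carrier X"
  shows "delta2_1 X A (inv\<^bsub>C2_PA X A\<^esub> \<eta>) x1 x2 x3 x4 x5 = inv (delta2_1 X A \<eta> x1 x2 x3 x4 x5)"
  using assms by (simp add: delta2_1_def inv_mult m_ac)

lemma delta2_2_inv:
  assumes "\<eta> \<in> carrier (C2_PA X A)"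
    and "x1 \<in> carrier X" "x2 \<in> carrier X" "x3 \<in> carrier X" "x4 \<in> carrier X" "x5 \<in> carrier X"
  shows "delta2_2 X A (inv\<^bsub>C2_PA X A\<^esub> \<eta>) x1 x2 x3 x4 x5 = inv (delta2_2 X A \<eta> x1 x2 x3 x4 x5)"
  using assms by (simp add: delta2_2_def inv_mult m_ac)

lemma Z2_H_subset_C2: "\<eta> \<in> carrier (Z2_H X A) \<Longrightarrow> \<eta> \<in> carrier (C2_PA X A)"
  by (simp add: Z2_H_def Z2_PA_def)

lemma Z2_H_subgroup_C2: "subgroup (carrier (Z2_H X A)) (C2_PA X A)"
proof (rule group.subgroupI[OF group_C2])
  have "\<one>\<^bsub>C2_PA X A\<^esub> \<in> carrier (Z2_H X A)"
    using group_C2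
    by (simp add: Z2_H_def Z2_PA_def delta2_1_def delta2_2_def group.is_monoid monoid.one_closed)
  then show "carrier (Z2_H X A) \<noteq> {}" by blast
  show "carrier (Z2_H X A) \<subseteq> carrier (C2_PA X A)"
    using Z2_H_subset_C2 by blast
next
  fix \<eta> assume "\<eta> \<in> carrier (Z2_H X A)"
  then show "inv\<^bsub>C2_PA X A\<^esub> \<eta> \<in> carrier (Z2_H X A)"
    using group_C2 by (simp add: Z2_H_def Z2_PA_def delta2_1_inv delta2_2_inv group.inv_closed)
next
  fix \<eta> \<mu> assume "\<eta> \<in> carrier (Z2_H X A)" "\<mu> \<in> carrier (Z2_H X A)"
  then show "\<eta> \<otimes>\<^bsub>C2_PA X A\<^esub> \<mu> \<in> carrier (Z2_H X A)"
    using group_C2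
    by (simp add: Z2_H_def Z2_PA_def delta2_1_mult delta2_2_mult group.is_monoid monoid.m_closed)
qed

lemma group_Z2_H: "group (Z2_H X A)"
  using group.subgroup_imp_group[OF group_C2 Z2_H_subgroup_C2] by (simp add: Z2_H_def)

text \<open>
  The identity behind \<open>\<delta>\<^sup>2 \<delta>\<^sup>1 = 0\<close>: the three positive terms of \<open>\<delta>\<^sup>2\<close> telescope.  With \<open>a, \<dots>, e\<close>
  for the values of \<open>f\<close> at \<open>x\<^sub>1, \<dots>, x\<^sub>5\<close> and \<open>u, v, w\<close> for its values at
  \<open>[x\<^sub>1, x\<^sub>2, x\<^sub>3]\<close>, \<open>[x\<^sub>4, x\<^sub>3, x\<^sub>2]\<close> and the product of all five, this is the left-hand
  cocycle condition.  The right-hand one is the same identity for the five variables in reverse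
  order.
\<close>

lemma telescope:
  assumes [simp]: "a \<in> carrier A" "b \<in> carrier A" "c \<in> carrier A" "d \<in> carrier A" "e \<in> carrier A"
    "u \<in> carrier A" "v \<in> carrier A" "w \<in> carrier A"
  shows "(u \<otimes> inv a \<otimes> b \<otimes> inv c) \<otimes> (w \<otimes> inv u \<otimes> d \<otimes> inv e) \<otimes> (v \<otimes> inv d \<otimes> c \<otimes> inv b)
    = w \<otimes> inv a \<otimes> v \<otimes> inv e"
proof -
  have "(u \<otimes> inv a \<otimes> b \<otimes> inv c) \<otimes> (w \<otimes> inv u \<otimes> d \<otimes> inv e) \<otimes> (v \<otimes> inv d \<otimes> c \<otimes> inv b)
    = (u \<otimes> inv u) \<otimes> (b \<otimes> inv b) \<otimes> (c \<otimes> inv c) \<otimes> (d \<otimes> inv d) \<otimes> (w \<otimes> inv a \<otimes> v \<otimes> inv e)"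
    by (simp only: m_ac m_closed inv_closed assms)
  then show ?thesis by simp
qed

lemma delta2_1_delta1:
  assumes f: "f \<in> carrier (C1_PA X A)"
    and x: "x1 \<in> carrier X" "x2 \<in> carrier X" "x3 \<in> carrier X" "x4 \<in> carrier X" "x5 \<in> carrier X"
  shows "delta2_1 X A (delta1 X A f) x1 x2 x3 x4 x5 = \<one>"
  using x f by (simp add: delta2_1_def X.para_assoc_left telescope)

lemma delta2_2_delta1:
  assumes f: "f \<in> carrier (C1_PA X A)"
    and x: "x1 \<in> carrier X" "x2 \<in> carrier X" "x3 \<in> carrier X" "x4 \<in> carrier X" "x5 \<in> carrier X"
  shows "delta2_2 X A (delta1 X A f) x1 x2 x3 x4 x5 = \<one>"
proof -
  let ?u = "f (tern X x3 x4 x5)" and ?v = "f (tern X x4 x3 x2)"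
    and ?w = "f (tern X x1 (tern X x4 x3 x2) x5)"
  \<comment> \<open>Regrouped so that \<open>telescope\<close> applies to the values of \<open>f\<close> in the order \<open>x5, \<dots>, x1\<close>.\<close>
  have "(?u \<otimes> inv f x3 \<otimes> f x4 \<otimes> inv f x5) \<otimes> (?w \<otimes> inv f x1 \<otimes> f x2 \<otimes> inv ?u)
      \<otimes> (?v \<otimes> inv f x4 \<otimes> f x3 \<otimes> inv f x2)
    = (?u \<otimes> inv f x5 \<otimes> f x4 \<otimes> inv f x3) \<otimes> (?w \<otimes> inv ?u \<otimes> f x2 \<otimes> inv f x1)
      \<otimes> (?v \<otimes> inv f x2 \<otimes> f x3 \<otimes> inv f x4)"
    using x f by (simp add: m_ac)
  also have "\<dots> = ?w \<otimes> inv f x5 \<otimes> ?v \<otimes> inv f x1"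
    using x f by (intro telescope) auto
  also have "\<dots> = ?w \<otimes> inv f x1 \<otimes> ?v \<otimes> inv f x5"
    using x f by (simp add: m_ac)
  finally show ?thesis
    using x f by (simp add: delta2_2_def X.para_assoc_right[symmetric])
qed

lemma delta1_in_Z2_H:
  assumes f: "f \<in> carrier (C1_PA X A)"
  shows "delta1 X A f \<in> carrier (Z2_H X A)"
proof -
  have "f y \<otimes> inv f x \<otimes> f x \<otimes> inv f y = \<one>" "f x \<otimes> inv f x \<otimes> f y \<otimes> inv f y = \<one>"
    if "x \<in> carrier X" "y \<in> carrier X" for x y
    using that f by (simp_all add: m_assoc)
  then show ?thesis
    using f by (simp add: Z2_H_def Z2_PA_def delta2_1_delta1 delta2_2_delta1
        X.degenerate_left X.degenerate_right)
qed

lemma B2_subgroup_Z2_H: "subgroup (B2_PA X A) (Z2_H X A)"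
proof -
  have "B2_PA X A \<subseteq> carrier (Z2_H X A)"
    using delta1_in_Z2_H by (auto simp: B2_PA_def)
  from group.subgroup_incl[OF group_C2 B2_subgroup_C2 Z2_H_subgroup_C2 this]
  show ?thesis by (simp add: Z2_H_def)
qed

lemma rcos_eq_iff:
  assumes \<eta>: "\<eta> \<in> carrier (Z2_H X A)" and \<eta>': "\<eta>' \<in> carrier (Z2_H X A)"
  shows "B2_PA X A #>\<^bsub>Z2_H X A\<^esub> \<eta> = B2_PA X A #>\<^bsub>Z2_H X A\<^esub> \<eta>'
    \<longleftrightarrow> (\<exists>f\<in>carrier (C1_PA X A). \<eta>' = delta1 X A f \<otimes>\<^bsub>C2_PA X A\<^esub> \<eta>)"
proof -
  have "B2_PA X A #>\<^bsub>Z2_H X A\<^esub> \<eta> = B2_PA X A #>\<^bsub>Z2_H X A\<^esub> \<eta>'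
      \<longleftrightarrow> \<eta>' \<in> B2_PA X A #>\<^bsub>Z2_H X A\<^esub> \<eta>"
    using group.repr_independence[OF group_Z2_H _ \<eta> B2_subgroup_Z2_H]
      group.repr_independenceD[OF group_Z2_H B2_subgroup_Z2_H \<eta>'] by blast
  then show ?thesis
    by (auto simp: r_coset_def B2_PA_def Z2_H_def)
qed

lemma carrier_H2_H:
  "carrier (H2_H X A) = (\<lambda>\<eta>. B2_PA X A #>\<^bsub>Z2_H X A\<^esub> \<eta>) ` carrier (Z2_H X A)"
  by (auto simp: H2_H_def FactGroup_def RCOSETS_def)

section \<open>Morphisms of extensions as shears\<close>

definition shear :: "('x \<Rightarrow> 'a) \<Rightarrow> 'x \<times> 'a \<Rightarrow> 'x \<times> 'a" where
  "shear f = (\<lambda>(x, a). (x, f x \<otimes> a))"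

lemma shear_apply [simp]: "shear f (x, a) = (x, f x \<otimes> a)"
  by (simp add: shear_def)

lemma carrier_heap_extension [simp]: "carrier (heap_extension X A \<eta>) = carrier X \<times> carrier A"
  by (simp add: heap_extension_def)

lemma tern_heap_extension [simp]:
  "tern (heap_extension X A \<eta>) (x, a) (y, b) (z, c)
    = (tern X x y z, a \<otimes> inv b \<otimes> c \<otimes> \<eta> (x, y, z))"
  by (simp add: heap_extension_def)

text \<open>
  The computation at a single triple of points: the fibre coordinates \<open>a, b, c\<close> enter both sides
  through the same factor and cancel, so that the condition on them becomes one on the base.
\<close>

lemma shear_compatible_iff:
  assumes [simp]: "a \<in> carrier A" "b \<in> carrier A" "c \<in> carrier A" "p \<in> carrier A" "q \<in> carrier A"
    "r \<in> carrier A" "s \<in> carrier A" "h \<in> carrier A" "h' \<in> carrier A"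
  shows "s \<otimes> (a \<otimes> inv b \<otimes> c \<otimes> h) = (p \<otimes> a) \<otimes> inv (q \<otimes> b) \<otimes> (r \<otimes> c) \<otimes> h'
    \<longleftrightarrow> h' = (s \<otimes> inv p \<otimes> q \<otimes> inv r) \<otimes> h"
proof -
  define t where "t = p \<otimes> inv q \<otimes> r \<otimes> (a \<otimes> inv b \<otimes> c)"
  have t [simp]: "t \<in> carrier A" by (simp add: t_def)
  have "(p \<otimes> a) \<otimes> inv (q \<otimes> b) \<otimes> (r \<otimes> c) \<otimes> h' = t \<otimes> h'"
    by (simp add: t_def inv_mult m_ac)
  moreover have "s \<otimes> (a \<otimes> inv b \<otimes> c \<otimes> h) = t \<otimes> ((s \<otimes> inv p \<otimes> q \<otimes> inv r) \<otimes> h)"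
  proof -
    have "t \<otimes> ((s \<otimes> inv p \<otimes> q \<otimes> inv r) \<otimes> h)
      = (p \<otimes> inv p) \<otimes> (q \<otimes> inv q) \<otimes> (r \<otimes> inv r) \<otimes> (s \<otimes> (a \<otimes> inv b \<otimes> c \<otimes> h))"
      unfolding t_def by (simp only: m_ac m_closed inv_closed assms)
    then show ?thesis by simp
  qed
  ultimately show ?thesis
    by (simp add: eq_commute)
qed

lemma shear_hom_iff:
  assumes f: "f \<in> carrier (C1_PA X A)"
    and \<eta>: "\<eta> \<in> carrier (C2_PA X A)" and \<eta>': "\<eta>' \<in> carrier (C2_PA X A)"
  shows "shear f \<in> extension_hom A (heap_extension X A \<eta>) (heap_extension X A \<eta>')
    \<longleftrightarrow> \<eta>' = delta1 X A f \<otimes>\<^bsub>C2_PA X A\<^esub> \<eta>" (is "?L \<longleftrightarrow> ?R")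
proof -
  have prod_closed: "delta1 X A f \<otimes>\<^bsub>C2_PA X A\<^esub> \<eta> \<in> carrier (C2_PA X A)"
    using f \<eta> group_C2 by (simp add: group.is_monoid monoid.m_closed)
  have "?L \<longleftrightarrow> shear f \<in> heap_hom (heap_extension X A \<eta>) (heap_extension X A \<eta>')"
    using f by (auto simp: extension_hom_def m_assoc)
  also have "\<dots> \<longleftrightarrow> (\<forall>x\<in>carrier X. \<forall>a\<in>carrier A. \<forall>y\<in>carrier X. \<forall>b\<in>carrier A.
      \<forall>z\<in>carrier X. \<forall>c\<in>carrier A.
      f (tern X x y z) \<otimes> (a \<otimes> inv b \<otimes> c \<otimes> \<eta> (x, y, z))
        = (f x \<otimes> a) \<otimes> inv (f y \<otimes> b) \<otimes> (f z \<otimes> c) \<otimes> \<eta>' (x, y, z))"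
    using f by (auto simp: heap_hom_def)
  also have "\<dots> \<longleftrightarrow> (\<forall>x\<in>carrier X. \<forall>y\<in>carrier X. \<forall>z\<in>carrier X.
      \<eta>' (x, y, z) = (f (tern X x y z) \<otimes> inv f x \<otimes> f y \<otimes> inv f z) \<otimes> \<eta> (x, y, z))"
    using f \<eta> \<eta>' by (simp add: shear_compatible_iff) blast
  also have "\<dots> \<longleftrightarrow> ?R"
    using prod_closed \<eta>' by (auto intro: C2_eqI)
  finally show ?thesis .
qed


text \<open>
  Compatibility with translations forces \<open>\<phi> (x, a) = \<phi> (x, \<one> \<otimes> a)\<close> to be the translate of
  \<open>\<phi> (x, \<one>)\<close> by \<open>a\<close>, so \<open>f\<close> is read off from the unit section.
\<close>

lemma extension_hom_eq_shear:
  assumes \<phi>: "\<phi> \<in> extension_hom A (heap_extension X A \<eta>) (heap_extension X A \<eta>')"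
  obtains f where "f \<in> carrier (C1_PA X A)"
    "\<And>p. p \<in> carrier X \<times> carrier A \<Longrightarrow> \<phi> p = shear f p"
proof
  let ?f = "\<lambda>x\<in>carrier X. snd (\<phi> (x, \<one>))"
  have maps: "\<phi> p \<in> carrier X \<times> carrier A" if "p \<in> carrier X \<times> carrier A" for p
    using \<phi> that by (auto simp: extension_hom_def heap_hom_def)
  have "snd (\<phi> (x, \<one>)) \<in> carrier A" if "x \<in> carrier X" for x
    using maps[of "(x, \<one>)"] that by (simp add: mem_Times_iff)
  then show "?f \<in> carrier (C1_PA X A)"
    by (auto simp: C1_PA_def)
  fix p assume "p \<in> carrier X \<times> carrier A"
  then obtain x a where p: "p = (x, a)" "x \<in> carrier X" "a \<in> carrier A" by blast
  have "\<phi> (x, \<one> \<otimes> a) = map_prod id (\<lambda>c. c \<otimes> a) (\<phi> (x, \<one>))"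
    using \<phi> p unfolding extension_hom_def by fastforce
  moreover have "fst (\<phi> (x, \<one>)) = x"
    using \<phi> p unfolding extension_hom_def by fastforce
  ultimately show "\<phi> p = shear ?f p"
    using p(2,3) unfolding p(1) by (simp add: prod_eq_iff)
qed

lemma extension_hom_cong:
  assumes \<eta>: "\<eta> \<in> carrier (C2_PA X A)"
    and \<phi>: "\<phi> \<in> extension_hom A (heap_extension X A \<eta>) F"
    and eq: "\<And>p. p \<in> carrier X \<times> carrier A \<Longrightarrow> \<phi> p = \<psi> p"
  shows "\<psi> \<in> extension_hom A (heap_extension X A \<eta>) F"
proof -
  have "tern (heap_extension X A \<eta>) p q r \<in> carrier X \<times> carrier A"
    if "p \<in> carrier X \<times> carrier A" "q \<in> carrier X \<times> carrier A" "r \<in> carrier X \<times> carrier A" for p q r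
    using that \<eta> by auto
  then show ?thesis
    using \<phi> by (auto simp: extension_hom_def heap_hom_def eq[symmetric] Pi_iff simp del: tern_heap_extension)
qed

section \<open>Isomorphism of extensions is equality of cohomology classes\<close>

lemma extension_isomorphic_iff_rcos_eq:
  assumes Z: "\<eta> \<in> carrier (Z2_H X A)" "\<eta>' \<in> carrier (Z2_H X A)"
  shows "extension_isomorphic A (heap_extension X A \<eta>) (heap_extension X A \<eta>')
    \<longleftrightarrow> B2_PA X A #>\<^bsub>Z2_H X A\<^esub> \<eta> = B2_PA X A #>\<^bsub>Z2_H X A\<^esub> \<eta>'"
    (is "?iso \<longleftrightarrow> ?eq")
proof
  note \<eta> = Z2_H_subset_C2[OF Z(1)] and \<eta>' = Z2_H_subset_C2[OF Z(2)]
  {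
    assume ?iso
    then obtain \<phi> where \<phi>: "\<phi> \<in> extension_hom A (heap_extension X A \<eta>) (heap_extension X A \<eta>')"
      by (auto simp: extension_isomorphic_def)
    then obtain f where f: "f \<in> carrier (C1_PA X A)"
      and "\<And>p. p \<in> carrier X \<times> carrier A \<Longrightarrow> \<phi> p = shear f p"
      by (rule extension_hom_eq_shear) blast
    then have "shear f \<in> extension_hom A (heap_extension X A \<eta>) (heap_extension X A \<eta>')"
      using extension_hom_cong[OF \<eta> \<phi>] by blast
    then show ?eq
      using rcos_eq_iff[OF Z] shear_hom_iff[OF f \<eta> \<eta>'] f by blast
  }
  assume ?eq
  then obtain f where f: "f \<in> carrier (C1_PA X A)"
    and eq: "\<eta>' = delta1 X A f \<otimes>\<^bsub>C2_PA X A\<^esub> \<eta>"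
    using rcos_eq_iff[OF Z] by blast
  let ?g = "inv\<^bsub>C1_PA X A\<^esub> f"
  have g: "?g \<in> carrier (C1_PA X A)"
    using f group_C1 by (simp add: group.inv_closed)
  have "\<eta> = inv\<^bsub>C2_PA X A\<^esub> (delta1 X A f) \<otimes>\<^bsub>C2_PA X A\<^esub> \<eta>'"
    using group.inv_solve_left[OF group_C2 \<eta>, of "delta1 X A f" \<eta>'] \<eta>' f eq by simp
  then have eq': "\<eta> = delta1 X A ?g \<otimes>\<^bsub>C2_PA X A\<^esub> \<eta>'"
    using group_hom.hom_inv[OF delta1_group_hom f] by simp
  have "shear f \<in> extension_hom A (heap_extension X A \<eta>) (heap_extension X A \<eta>')"
    using shear_hom_iff[OF f \<eta> \<eta>'] eq by blast
  moreover have "shear ?g \<in> extension_hom A (heap_extension X A \<eta>') (heap_extension X A \<eta>)"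
    using shear_hom_iff[OF g \<eta>' \<eta>] eq' by blast
  moreover have "shear ?g (shear f p) = p" "shear f (shear ?g p) = p"
    if "p \<in> carrier X \<times> carrier A" for p
    using that f by (auto simp: m_assoc[symmetric])
  ultimately show ?iso
    unfolding extension_isomorphic_def carrier_heap_extension by blast
qed

end

theorem proposition3p16:
  fixes X :: "('x, 'm) ternary_scheme" and A :: "('a, 'b) monoid_scheme"
  assumes "heap X" and "comm_group A"
  shows "\<exists>\<Phi>. bij_betw \<Phi> (extension_iso_classes X A) (carrier (H2_H X A)) \<and>
    (\<forall>\<eta>\<in>carrier (Z2_H X A).
       \<Phi> (extension_iso_rel X A `` {heap_extension X A \<eta>}) = B2_PA X A #>\<^bsub>Z2_H X A\<^esub> \<eta>)"
proof -
  interpret heap_coefficients X A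
    using assms by (simp add: heap_coefficients_def)
  show ?thesis
    unfolding extension_iso_classes_def heap_extensions_def carrier_H2_H
    by (rule quotient_bij_betw_complete_invariant)
      (auto simp: extension_iso_rel_def heap_extensions_def extension_isomorphic_iff_rcos_eq)
qed

end
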